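(* Let $f \in \mathbb{K}[z]$ be a polynomial of degree $n \ge 2$, let $1 \le p \le \infty$, let $q$ be the conjugate exponent of $p$, and put $a = (n-1)^{1/q}$. Suppose there exists a vector $x \in \mathbb{K}^n$ with distinct components such that $$E_f(x) = \left\| \frac{W_f(x)}{d(x)} \right\|_p \le \frac{1}{(1+\sqrt{a})^2}.$$ In the case when $n = 2$ and $p = \infty$, assume that this inequality is strict. Then $f$ has only simple zeros in $\mathbb{K}$. Besides, for any real number $c \in [\alpha(E_f(x)), \beta(E_f(x))]$, where $$\alpha(t) = \frac{2}{1-(a-1)t+\sqrt{(1-(a-1)t)^2-4t}}, \qquad \beta(t) = \frac{2}{1-(a-1)t},$$ the closed disks $$D_i = \{z \in \mathbb{K} : |z - x_i| \le c\,|W_i(x)|\}, \qquad i = 1,2,\ldots,n,$$ are mutually disjoint and each of them contains exactly one zero of $f$.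
   Context: $(\mathbb{K},|\cdot|)$ is an algebraically closed normed field (a field with an absolute value) and $\mathbb{K}[z]$ is the ring of polynomials over $\mathbb{K}$. For $1 \le p \le \infty$, the $p$-norm on $\mathbb{K}^n$ and on $\mathbb{R}^n$ is $\|x\|_p = \left(\sum_{i=1}^n |x_i|^p\right)^{1/p}$ ($\|x\|_\infty = \max_i |x_i|$). The conjugate exponent $q$ of $p$ is defined by $1 \le q \le \infty$ and $1/p+1/q=1$ (with $1/\infty = 0$). For $x \in \mathbb{K}^n$, $d(x) = (d_1(x),\ldots,d_n(x)) \in \mathbb{R}^n$ with $d_i(x) = \min_{j\ne i}|x_i-x_j|$. For $x \in \mathbb{K}^n$ and $y \in \mathbb{R}^n$ with no zero components, $\frac{x}{y} = \left(\frac{|x_1|}{y_1},\ldots,\frac{|x_n|}{y_n}\right) \in \mathbb{R}^n$. For a polynomial $f \in \mathbb{K}[z]$ of degree $n \ge 2$ with leading coefficient $a_0$ and a vector $x \in \mathbb{K}^n$ with distinct components, the Weierstrass correction is $W_f(x) = (W_1(x),\ldots,W_n(x))$ with $W_i(x) = \frac{f(x_i)}{a_0\prod_{j\ne i}(x_i-x_j)}$. *)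

theory Defs
  imports "HOL-Analysis.Analysis"
begin

text \<open>
  The absolute value is an explicit function: the library class \<open>real_normed_field\<close> is
  restricted to algebras over the reals, and would exclude all non-Archimedean fields.
\<close>

locale absolute_value =
  fixes abv :: "'a::field \<Rightarrow> real"
  assumes nonneg: "abv x \<ge> 0"
    and eq_zero_iff: "abv x = 0 \<longleftrightarrow> x = 0"
    and mult: "abv (x * y) = abv x * abv y"
    and triangle: "abv (x + y) \<le> abv x + abv y"

text \<open>Meant for \<open>1 \<le> p \<le> \<infinity>\<close>.\<close>

definition p_norm :: "ereal \<Rightarrow> real ^ 'n \<Rightarrow> real" where
  "p_norm p x =
     (if p = \<infinity> then Max (range (\<lambda>i. \<bar>x $ i\<bar>))
      else (\<Sum>i\<in>UNIV. \<bar>x $ i\<bar> powr real_of_ereal p) powr (1 / real_of_ereal p))"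

text \<open>The conditions force \<open>p\<close> and \<open>q\<close> into \<open>[1, \<infinity>]\<close>; in \<^typ>\<open>ereal\<close>, \<open>1 / \<infinity> = 0\<close>.\<close>

definition conjugate_exponents :: "ereal \<Rightarrow> ereal \<Rightarrow> bool" where
  "conjugate_exponents p q \<longleftrightarrow> 1 \<le> p \<and> 1 \<le> q \<and> 1 / p + 1 / q = 1"

text \<open>Needs at least two components, since the minimum is otherwise over the empty set.\<close>

definition min_dist :: "('a::field \<Rightarrow> real) \<Rightarrow> 'a ^ 'n \<Rightarrow> real ^ 'n" where
  "min_dist abv x = (\<chi> i. Min ((\<lambda>j. abv (x $ i - x $ j)) ` (UNIV - {i})))"

definition abv_quot :: "('a::field \<Rightarrow> real) \<Rightarrow> 'a ^ 'n \<Rightarrow> real ^ 'n \<Rightarrow> real ^ 'n" where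
  "abv_quot abv x y = (\<chi> i. abv (x $ i) / y $ i)"

definition weierstrass_corr :: "'a::field poly \<Rightarrow> 'a ^ 'n \<Rightarrow> 'a ^ 'n" where
  "weierstrass_corr f x =
     (\<chi> i. poly f (x $ i) / (lead_coeff f * (\<Prod>j\<in>UNIV - {i}. x $ i - x $ j)))"

definition init_fun :: "('a::field \<Rightarrow> real) \<Rightarrow> ereal \<Rightarrow> 'a poly \<Rightarrow> 'a ^ 'n \<Rightarrow> real" where
  "init_fun abv p f x = p_norm p (abv_quot abv (weierstrass_corr f x) (min_dist abv x))"

definition alpha_fun :: "real \<Rightarrow> real \<Rightarrow> real" where
  "alpha_fun a t = 2 / (1 - (a - 1) * t + sqrt ((1 - (a - 1) * t)\<^sup>2 - 4 * t))"

definition beta_fun :: "real \<Rightarrow> real \<Rightarrow> real" where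
  "beta_fun a t = 2 / (1 - (a - 1) * t)"

definition abv_cball :: "('a::field \<Rightarrow> real) \<Rightarrow> 'a \<Rightarrow> real \<Rightarrow> 'a set" where
  "abv_cball abv x r = {z. abv (z - x) \<le> r}"

end

theory Submission
  imports Defs
begin

text \<open>
  Write \<open>W = weierstrass_corr f x\<close>, \<open>d = min_dist abv x\<close>, \<open>t = init_fun abv p f x\<close>,
  \<open>n = CARD('n)\<close> and \<open>a\<^sub>0 = lead_coeff f\<close>. Lagrange interpolation at the points \<open>x $ j\<close> gives, for
  every \<open>i\<close> (\<open>weierstrass_representation_at\<close>),

  \<open>f(z) = a\<^sub>0 (\<Prod>j\<noteq>i. z - x\<^sub>j) (W\<^sub>i + (z - x\<^sub>i) (1 + S\<^sub>i(z)))\<close>, where \<open>S\<^sub>i(z) = \<Sum>j\<noteq>i. W\<^sub>j / (z - x\<^sub>j)\<close>,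

  so near \<open>x\<^sub>i\<close> the zeros of \<open>f\<close> are the fixed points of \<open>\<phi>\<^sub>i(z) = x\<^sub>i - W\<^sub>i / (1 + S\<^sub>i(z))\<close>. By Hoelder's
  inequality (\<open>sum_abs_le_p_norm\<close>) the sum of \<open>|W\<^sub>j| / d\<^sub>j\<close> over \<open>j \<noteq> i\<close> is at most \<open>a t\<close>. Hence, if
  \<open>|z - x\<^sub>i| \<le> s\<close>, then \<open>|\<phi>\<^sub>i(z) - x\<^sub>i| \<le> |W\<^sub>i| / (1 - a t / (1 - s / d\<^sub>i))\<close>. As \<open>|W\<^sub>i| / d\<^sub>i \<le> t\<close>, the map
  \<open>\<phi>\<^sub>i\<close> sends the disk of radius \<open>r |W\<^sub>i|\<close> about \<open>x\<^sub>i\<close> into itself if \<open>1 / (1 - a t / (1 - r t)) = r\<close>.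
  This is a quadratic equation for \<open>r\<close>, whose smaller solution is \<open>\<alpha>(t)\<close>; the bound
  \<open>t \<le> 1 / (1 + \<surd>a)\<^sup>2\<close> says that \<open>2 \<surd>t \<le> 1 - (a - 1) t\<close>, which makes the solutions real and positive.

  The field need not be complete, so a Cauchy sequence of iterates need not have a limit. It is enough,
  however, that the steps of the iteration tend to \<open>0\<close>: then \<open>f\<close> takes arbitrarily small values in the
  disk (\<open>approximate_fixed_point\<close>), while a polynomial that splits into linear factors is bounded away
  from \<open>0\<close> on a disk that contains none of its zeros (\<open>root_in_cball\<close>). That the steps tend to \<open>0\<close> is
  shown by Kantorovich's majorant method: they are dominated by the steps of a bounded monotone
  sequence of reals. This covers the extremal value of \<open>t\<close> too, where \<open>\<phi>\<^sub>i\<close> may fail to be a strict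
  contraction of the disk.

  So each disk of radius \<open>c |W\<^sub>i|\<close> with \<open>c \<ge> \<alpha>(t)\<close> contains a zero of \<open>f\<close>. For \<open>c \<le> \<beta>(t)\<close> the disks are
  disjoint: two that meet would satisfy
  \<open>|x\<^sub>i - x\<^sub>j| \<le> c (|W\<^sub>i| + |W\<^sub>j|) \<le> \<beta>(t) 2\<^bsup>1/q\<^esup> t |x\<^sub>i - x\<^sub>j|\<close>, and \<open>\<beta>(t) 2\<^bsup>1/q\<^esup> t < 1\<close>
  (\<open>beta_two_disks_lt_1\<close>). The last inequality is where the case \<open>n = 2\<close>, \<open>p = \<infinity>\<close> is exceptional.
  Now \<open>n\<close> disjoint sets each contain one of the at most \<open>n\<close> zeros of \<open>f\<close>, counted with multiplicity;
  so each contains exactly one, and all zeros are simple (\<open>roots_in_disjoint_sets\<close>).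
\<close>

section \<open>Absolute values\<close>

context absolute_value
begin

lemma abv_0 [simp]: "abv 0 = 0"
  by (simp add: eq_zero_iff)

lemma abv_pos_iff: "abv x > 0 \<longleftrightarrow> x \<noteq> 0"
  using nonneg[of x] eq_zero_iff[of x] by linarith

lemma abv_1 [simp]: "abv 1 = 1"
  using mult[of 1 1] eq_zero_iff[of 1] by simp

lemma abv_minus [simp]: "abv (- x) = abv x"
proof -
  have "abv (- 1) * abv (- 1) = 1"
    using mult[of "- 1" "- 1"] by simp
  then have "abv (- 1) = 1"
    using nonneg[of "- 1"] by (simp add: square_eq_1_iff)
  then show ?thesis
    using mult[of "- 1" x] by simp
qed

lemma abv_commute: "abv (x - y) = abv (y - x)"
  using abv_minus[of "x - y"] by simp

lemma abv_diff_triangle: "abv (x - z) \<le> abv (x - y) + abv (y - z)"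
  using triangle[of "x - y" "y - z"] by simp

lemma abv_diff_ge: "abv x - abv y \<le> abv (x - y)"
  using triangle[of "x - y" y] by simp

lemma abv_divide: "abv (x / y) = abv x / abv y"
proof (cases "y = 0")
  case False
  then have "abv x = abv (x / y) * abv y"
    using mult[of "x / y" y] by simp
  with False show ?thesis
    by (simp add: eq_zero_iff field_simps)
qed simp

lemma abv_prod: "abv (prod g A) = (\<Prod>i\<in>A. abv (g i))"
  by (induction A rule: infinite_finite_induct) (simp_all add: mult)

lemma abv_sum: "abv (sum g A) \<le> (\<Sum>i\<in>A. abv (g i))"
proof (induction A rule: infinite_finite_induct)
  case (insert j A)
  then show ?case
    using triangle[of "g j" "sum g A"] by simp
qed simp_all

end

section \<open>The Weierstrass representation\<close>

text \<open>
  Both sides have degree at most \<open>CARD('n)\<close> and the same coefficient there, and they agree at the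
  \<open>CARD('n)\<close> points \<open>x $ k\<close>: at such a point only the summand for \<open>i = k\<close> survives, and the definition
  of the correction makes it equal to \<open>poly f (x $ k)\<close>.
\<close>

lemma weierstrass_representation:
  fixes f :: "'a::field poly" and x :: "'a ^ 'n"
  assumes deg: "degree f = CARD('n)" and inj: "inj (\<lambda>i. x $ i)"
  shows "poly f z = lead_coeff f * ((\<Prod>j\<in>UNIV. z - x $ j)
    + (\<Sum>i\<in>UNIV. weierstrass_corr f x $ i * (\<Prod>j\<in>UNIV - {i}. z - x $ j)))"
proof -
  let ?W = "weierstrass_corr f x" and ?n = "CARD('n)"
  define P where "P A = (\<Prod>j\<in>A. [:- (x $ j), 1:])" for A
  define G where "G = (\<Sum>i\<in>UNIV. smult (?W $ i) (P (UNIV - {i})))"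
  define H where "H = smult (lead_coeff f) (P UNIV + G)"
  have poly_P: "poly (P A) z = (\<Prod>j\<in>A. z - x $ j)" for A z
    by (simp add: P_def poly_prod)
  have deg_P: "degree (P A) = card A" for A
    unfolding P_def by (subst degree_prod_sum_eq) auto
  have "degree G < ?n"
    unfolding G_def
    by (intro degree_sum_less) (auto simp: deg_P card_Diff_singleton intro: le_less_trans[OF degree_smult_le])
  moreover have "lead_coeff (P UNIV) = 1"
    by (simp add: P_def lead_coeff_prod)
  ultimately have "coeff H ?n = lead_coeff f"
    by (simp add: H_def deg_P coeff_eq_0)
  moreover have "degree H \<le> ?n"
    unfolding H_def using \<open>degree G < ?n\<close>
    by (intro order_trans[OF degree_smult_le] degree_add_le) (auto simp: deg_P)
  moreover have "poly f (x $ k) = poly H (x $ k)" for k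
  proof -
    let ?Q = "\<Prod>j\<in>UNIV - {k}. x $ k - x $ j"
    have "?Q \<noteq> 0"
      using inj by (auto simp: inj_eq)
    have "f \<noteq> 0"
      using deg by auto
    have "(\<Prod>j\<in>UNIV - {i}. x $ k - x $ j) = 0" if "i \<noteq> k" for i
      using that by auto
    then have "(\<Sum>i\<in>UNIV. ?W $ i * (\<Prod>j\<in>UNIV - {i}. x $ k - x $ j))
        = (\<Sum>i\<in>UNIV. if i = k then ?W $ k * ?Q else 0)"
      by (intro sum.cong) auto
    also have "\<dots> = ?W $ k * ?Q"
      by simp
    finally have "poly H (x $ k) = lead_coeff f * (?W $ k * ?Q)"
      by (auto simp: H_def G_def poly_P poly_sum)
    also have "\<dots> = lead_coeff f * ?Q * (poly f (x $ k) / (lead_coeff f * ?Q))"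
      by (simp add: weierstrass_corr_def)
    finally show ?thesis
      using \<open>?Q \<noteq> 0\<close> \<open>f \<noteq> 0\<close> by (simp del: prod_zero_iff)
  qed
  ultimately have "f = H"
    using deg inj
    by (intro poly_eqI_degree_lead_coeff[of f ?n H "range (\<lambda>i. x $ i)"]) (auto simp: card_image)
  then have "poly f z = poly H z"
    by (rule arg_cong)
  then show ?thesis
    by (simp add: H_def G_def poly_P poly_sum)
qed

text \<open>
  The index \<open>i\<close> is singled out so that the formula also makes sense at \<open>z = x $ i\<close>, where the iteration
  starts.
\<close>

lemma weierstrass_representation_at:
  fixes f :: "'a::field poly" and x :: "'a ^ 'n"
  assumes "degree f = CARD('n)" "inj (\<lambda>i. x $ i)" and z: "\<And>j. j \<noteq> i \<Longrightarrow> z \<noteq> x $ j"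
  shows "poly f z = lead_coeff f * (\<Prod>j\<in>UNIV - {i}. z - x $ j)
    * (weierstrass_corr f x $ i + (z - x $ i) *
        (1 + (\<Sum>j\<in>UNIV - {i}. weierstrass_corr f x $ j / (z - x $ j))))"
proof -
  let ?W = "weierstrass_corr f x" and ?Q = "\<Prod>j\<in>UNIV - {i}. z - x $ j"
  have split_prod: "(\<Prod>j\<in>UNIV. z - x $ j) = (z - x $ i) * ?Q"
    by (simp add: prod.remove[of UNIV i])
  have split_sum: "(\<Sum>k\<in>UNIV. ?W $ k * (\<Prod>j\<in>UNIV - {k}. z - x $ j))
      = ?W $ i * ?Q + (\<Sum>k\<in>UNIV - {i}. ?W $ k * (\<Prod>j\<in>UNIV - {k}. z - x $ j))"
    by (simp add: sum.remove[of UNIV i])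
  have reduced_sum: "(\<Sum>k\<in>UNIV - {i}. ?W $ k * (\<Prod>j\<in>UNIV - {k}. z - x $ j))
      = (z - x $ i) * ?Q * (\<Sum>k\<in>UNIV - {i}. ?W $ k / (z - x $ k))"
    unfolding sum_distrib_left
  proof (intro sum.cong refl)
    fix k assume k: "k \<in> UNIV - {i}"
    have "(\<Prod>j\<in>UNIV - {k}. z - x $ j) * (z - x $ k) = (\<Prod>j\<in>UNIV. z - x $ j)"
      by (simp add: prod.remove[of UNIV k] mult.commute)
    also have "\<dots> = (z - x $ i) * ?Q"
      by (simp add: prod.remove[of UNIV i])
    finally have "(\<Prod>j\<in>UNIV - {k}. z - x $ j) = (z - x $ i) * ?Q / (z - x $ k)"
      using z[of k] k by (simp add: eq_divide_eq)
    then show "?W $ k * (\<Prod>j\<in>UNIV - {k}. z - x $ j) = (z - x $ i) * ?Q * (?W $ k / (z - x $ k))"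
      by simp
  qed
  show ?thesis
    unfolding weierstrass_representation[OF assms(1,2), of z] split_prod split_sum reduced_sum
    by (simp add: algebra_simps)
qed

section \<open>The \<open>p\<close>-norm\<close>

text \<open>
  Jensen's inequality for \<open>\<lambda>y. y powr P\<close> with equal weights. Positivity of all \<open>u i\<close> is required because
  \<open>powr_convex\<close> speaks of the open half-line.
\<close>

lemma power_mean_inequality:
  fixes u :: "'i \<Rightarrow> real"
  assumes "finite T" "T \<noteq> {}" "1 \<le> P" and pos: "\<And>i. i \<in> T \<Longrightarrow> 0 < u i"
  shows "sum u T \<le> real (card T) powr (1 - 1 / P) * (\<Sum>i\<in>T. u i powr P) powr (1 / P)"
proof -
  let ?N = "real (card T)"
  have N: "0 < ?N"
    using assms by (simp add: card_gt_0_iff)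
  have U: "0 < sum u T"
    using assms by (intro sum_pos) auto
  have "(\<Sum>i\<in>T. (1 / ?N) *\<^sub>R u i) powr P \<le> (\<Sum>i\<in>T. (1 / ?N) * u i powr P)"
    using assms N by (intro convex_on_sum[OF _ _ powr_convex]) auto
  then have "(sum u T / ?N) powr P \<le> (\<Sum>i\<in>T. u i powr P) / ?N"
    by (simp add: sum_divide_distrib)
  then have "((sum u T / ?N) powr P) powr (1 / P) \<le> ((\<Sum>i\<in>T. u i powr P) / ?N) powr (1 / P)"
    using assms by (intro powr_mono2) auto
  then have "sum u T / ?N \<le> (\<Sum>i\<in>T. u i powr P) powr (1 / P) / ?N powr (1 / P)"
    using assms U N by (simp add: powr_powr powr_divide sum_nonneg)
  then have "sum u T \<le> ?N / ?N powr (1 / P) * (\<Sum>i\<in>T. u i powr P) powr (1 / P)"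
    using N by (simp add: field_simps)
  then show ?thesis
    using N by (simp add: powr_diff)
qed

lemma conjugate_exponents_cases:
  assumes "conjugate_exponents p q"
  obtains "p = \<infinity>" "real_of_ereal (1 / q) = 1"
  | P where "p = ereal P" "1 \<le> P" "real_of_ereal (1 / q) = 1 - 1 / P"
proof -
  have pq: "1 \<le> p" "1 \<le> q" "1 / p + 1 / q = 1"
    using assms by (auto simp: conjugate_exponents_def)
  show thesis
  proof (cases p)
    case (real P)
    then have P: "1 \<le> P"
      using pq by simp
    have "real_of_ereal (1 / q) = 1 - 1 / P"
      using pq real P by (cases q) (auto simp: one_ereal_def split: if_splits)
    with real P show thesis
      using that by blast
  next
    case PInf
    then have "1 / q = 1"
      using pq by simp
    with PInf show thesis
      using that by simp
  qed (use pq in simp)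
qed

lemma p_norm_nonneg: "0 \<le> p_norm p v"
proof (cases "p = \<infinity>")
  case True
  have "\<bar>v $ undefined\<bar> \<le> Max (range (\<lambda>i. \<bar>v $ i\<bar>))"
    by (intro Max_ge) auto
  then have "0 \<le> Max (range (\<lambda>i. \<bar>v $ i\<bar>))"
    by linarith
  then show ?thesis
    using True by (simp add: p_norm_def)
qed (simp add: p_norm_def)

text \<open>
  The case of Hoelder's inequality in which one factor is the indicator of \<open>S\<close>. It is applied to
  \<open>UNIV - {i}\<close>, which produces \<open>a\<close>, to \<open>{i, j}\<close>, which produces \<open>2\<^bsup>1/q\<^esup>\<close>, and to \<open>{i}\<close>.
\<close>

lemma sum_abs_le_p_norm:
  fixes v :: "real ^ 'n"
  assumes "conjugate_exponents p q"
  shows "(\<Sum>i\<in>S. \<bar>v $ i\<bar>) \<le> real (card S) powr real_of_ereal (1 / q) * p_norm p v"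
  using assms
proof (cases rule: conjugate_exponents_cases)
  case 1
  have "(\<Sum>i\<in>S. \<bar>v $ i\<bar>) \<le> (\<Sum>i\<in>S. p_norm p v)"
    using 1 by (intro sum_mono) (auto simp: p_norm_def)
  then show ?thesis
    using 1 by simp
next
  case (2 P)
  \<comment> \<open>Zero components contribute nothing to either side; dropping them only decreases the cardinality.\<close>
  let ?T = "{i \<in> S. v $ i \<noteq> 0}"
  have eq: "(\<Sum>i\<in>S. \<bar>v $ i\<bar>) = (\<Sum>i\<in>?T. \<bar>v $ i\<bar>)"
    by (intro sum.mono_neutral_right) auto
  show ?thesis
  proof (cases "?T = {}")
    case True
    then have "(\<Sum>i\<in>S. \<bar>v $ i\<bar>) = 0"
      unfolding eq by (simp only: sum.empty)
    then show ?thesis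
      using p_norm_nonneg[of p v] by simp
  next
    case False
    have "(\<Sum>i\<in>?T. \<bar>v $ i\<bar>)
        \<le> real (card ?T) powr (1 - 1 / P) * (\<Sum>i\<in>?T. \<bar>v $ i\<bar> powr P) powr (1 / P)"
      using 2 False by (intro power_mean_inequality) auto
    also have "\<dots> \<le> real (card S) powr (1 - 1 / P) * (\<Sum>i\<in>UNIV. \<bar>v $ i\<bar> powr P) powr (1 / P)"
      using 2 by (intro mult_mono powr_mono2 sum_mono2 sum_nonneg) (auto intro: card_mono)
    finally show ?thesis
      using 2 eq by (simp add: p_norm_def)
  qed
qed

section \<open>The radii\<close>

context
  fixes a t :: real
  assumes a: "1 \<le> a" and t: "0 \<le> t" "t \<le> 1 / (1 + sqrt a)\<^sup>2"
begin

lemma one_plus_sqrt_times_sqrt_le: "(1 + sqrt a) * sqrt t \<le> 1"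
proof -
  have "sqrt t \<le> sqrt (1 / (1 + sqrt a)\<^sup>2)"
    using t by simp
  also have "\<dots> = 1 / (1 + sqrt a)"
    using a by (simp add: real_sqrt_divide)
  finally show ?thesis
    using a by (simp add: field_simps add_pos_nonneg)
qed

text \<open>
  With \<open>r = \<surd>a\<close> and \<open>s = \<surd>t\<close>, the difference of the two sides factors as
  \<open>(1 - s - r s) (1 - s + r s)\<close>, so the bound on \<open>t\<close> is precisely what gives a nonnegative
  radicand in \<open>alpha_fun\<close>.
\<close>

lemma two_sqrt_le: "2 * sqrt t \<le> 1 - (a - 1) * t"
proof -
  define r s where "r = sqrt a" and "s = sqrt t"
  have rs: "a = r\<^sup>2" "t = s\<^sup>2" "1 \<le> r" "0 \<le> s" "(1 + r) * s \<le> 1"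
    using a t one_plus_sqrt_times_sqrt_le by (auto simp: r_def s_def)
  have "0 \<le> (1 - s - r * s) * (1 - s + r * s)"
    using rs mult_right_mono[of 1 r s] by (intro mult_nonneg_nonneg) (auto simp: algebra_simps)
  also have "\<dots> = 1 - (r\<^sup>2 - 1) * s\<^sup>2 - 2 * s"
    by (simp add: power2_eq_square algebra_simps)
  finally have "2 * s \<le> 1 - (a - 1) * t"
    using rs(1,2) by simp
  then show ?thesis
    by (simp add: s_def)
qed

lemma radicand_nonneg: "0 \<le> (1 - (a - 1) * t)\<^sup>2 - 4 * t"
  using power_mono[OF two_sqrt_le, of 2] t by (simp add: power_mult_distrib)

lemma denominator_pos: "0 < 1 - (a - 1) * t"
proof (cases "t = 0")
  case False
  then have "0 < 2 * sqrt t"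
    using t by simp
  then show ?thesis
    using two_sqrt_le by (rule less_le_trans)
qed simp

lemma alpha_pos: "0 < alpha_fun a t"
  unfolding alpha_fun_def using denominator_pos radicand_nonneg
  by (intro divide_pos_pos add_pos_nonneg) auto

lemma alpha_le_beta: "alpha_fun a t \<le> beta_fun a t"
  unfolding alpha_fun_def beta_fun_def using denominator_pos radicand_nonneg
  by (intro divide_left_mono mult_pos_pos add_pos_nonneg) auto

lemma beta_times_le_sqrt: "beta_fun a t * t \<le> sqrt t"
proof -
  have "2 * t = 2 * sqrt t * sqrt t"
    using t by simp
  also have "\<dots> \<le> (1 - (a - 1) * t) * sqrt t"
    using two_sqrt_le t by (intro mult_right_mono) auto
  finally show ?thesis
    using denominator_pos by (simp add: beta_fun_def field_simps)
qed

lemma beta_times_le: "beta_fun a t * t \<le> 1 / (1 + sqrt a)"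
proof -
  have "sqrt t \<le> 1 / (1 + sqrt a)"
    using one_plus_sqrt_times_sqrt_le a by (simp add: field_simps add_pos_nonneg)
  then show ?thesis
    using beta_times_le_sqrt by linarith
qed

text \<open>
  This keeps the denominators of the majorant positive. From \<open>\<alpha>(t) t \<le> s\<close> and \<open>(1 + r) s \<le> 1\<close>, in the
  notation above, one gets \<open>r\<^sup>2 s\<^sup>2 < r s \<le> 1 - s \<le> 1 - \<alpha>(t) t\<close> unless \<open>t = 0\<close>.
\<close>

lemma alpha_margin: "a * t < 1 - alpha_fun a t * t"
proof (cases "t = 0")
  case False
  define r s where "r = sqrt a" and "s = sqrt t"
  have rs: "a = r\<^sup>2" "t = s\<^sup>2" "1 \<le> r" "0 < s" "(1 + r) * s \<le> 1"
    using a t one_plus_sqrt_times_sqrt_le False by (auto simp: r_def s_def)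
  have "r * s < 1"
    using rs by (simp add: algebra_simps)
  then have "(r * s) * (r * s) < 1 * (r * s)"
    using rs by (intro mult_strict_right_mono) auto
  moreover have "alpha_fun a t * t \<le> s"
    using mult_right_mono[OF alpha_le_beta t(1)] beta_times_le_sqrt by (simp add: s_def)
  moreover have "a * t = (r * s) * (r * s)"
    using rs(1,2) by (simp add: power2_eq_square)
  ultimately show ?thesis
    using rs(5) by (simp add: distrib_right)
qed simp

text \<open>
  Cleared of denominators, this is the quadratic equation \<open>t \<alpha>\<^sup>2 - (1 - (a - 1) t) \<alpha> + 1 = 0\<close>.
\<close>

lemma alpha_fixed_point: "1 / (1 - a * t / (1 - alpha_fun a t * t)) = alpha_fun a t"
proof -
  define b D where "b = 1 - (a - 1) * t" and "D = sqrt (b\<^sup>2 - 4 * t)"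
  let ?\<alpha> = "alpha_fun a t"
  have \<alpha>: "?\<alpha> = 2 / (b + D)"
    by (simp add: alpha_fun_def b_def D_def)
  have bD: "0 < b + D" "D\<^sup>2 = b\<^sup>2 - 4 * t"
    using denominator_pos radicand_nonneg by (auto simp: b_def D_def intro: add_pos_nonneg)
  have "t * ?\<alpha>\<^sup>2 - b * ?\<alpha> + 1 = (4 * t - 2 * b * (b + D) + (b + D)\<^sup>2) / (b + D)\<^sup>2"
    unfolding \<alpha> using bD(1) by (simp add: divide_simps power2_eq_square)
  also have "4 * t - 2 * b * (b + D) + (b + D)\<^sup>2 = 0"
    using bD(2) by (simp add: power2_eq_square algebra_simps)
  finally have "?\<alpha> * (1 - ?\<alpha> * t - a * t) = 1 - ?\<alpha> * t"
    by (simp add: b_def power2_eq_square algebra_simps)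
  moreover have "0 \<le> a * t"
    using a t by simp
  ultimately show ?thesis
    using alpha_margin by (simp add: field_simps)
qed

end

section \<open>Zeros in a disk without completeness\<close>

context absolute_value
begin

text \<open>
  The relative form of the triangle inequality: \<open>d\<close> may be replaced by any lower bound, which allows one
  factor \<open>1 - s / d\<close> to serve all points \<open>y\<close> at once.
\<close>

lemma abv_diff_ge_scaled:
  assumes "0 < d" "d \<le> abv (c - y)" "abv (z - c) \<le> s"
  shows "abv (c - y) * (1 - s / d) \<le> abv (z - y)"
proof -
  have "0 \<le> s"
    using assms nonneg[of "z - c"] by linarith
  then have "s * d \<le> s * abv (c - y)"
    using assms by (intro mult_left_mono) auto
  then have "s \<le> abv (c - y) * (s / d)"
    using assms by (simp add: field_simps)
  moreover have "abv (c - y) \<le> abv (z - c) + abv (z - y)"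
    using abv_diff_triangle[of c y z] by (simp add: abv_commute)
  ultimately show ?thesis
    using assms by (simp add: algebra_simps)
qed

text \<open>
  The equation \<open>w + (z - c) (1 + S(z)) = 0\<close> is solved approximately by iterating
  \<open>\<phi>(z) = c - w / (1 + S(z))\<close> from \<open>c\<close>. The real function
  \<open>\<psi>(s) = |w| / (1 - \<sigma> / (1 - s / d))\<close> majorises \<open>\<phi>\<close>: it bounds \<open>|\<phi>(z) - c|\<close> for \<open>|z - c| \<le> s\<close>, and
  increments of \<open>\<phi>\<close> are bounded by increments of \<open>\<psi>\<close>. By \<open>\<psi>(R) \<le> R\<close> the \<open>\<psi>\<close>-iterates of \<open>0\<close> increase
  and stay below \<open>R\<close>, so their steps tend to \<open>0\<close>, and with them the steps of the \<open>\<phi>\<close>-iteration. The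
  residual of the equation at an iterate is \<open>1 + S(z)\<close> times the next step.
\<close>

lemma approximate_fixed_point:
  fixes c w :: 'a and v y :: "'j \<Rightarrow> 'a" and J :: "'j set"
  defines "S \<equiv> \<lambda>z. \<Sum>j\<in>J. v j / (z - y j)"
    and "\<sigma> \<equiv> \<Sum>j\<in>J. abv (v j) / abv (c - y j)"
  assumes d: "0 < d" "\<And>j. j \<in> J \<Longrightarrow> d \<le> abv (c - y j)"
    and R: "0 \<le> R" "\<sigma> < 1 - R / d" "abv w / (1 - \<sigma> / (1 - R / d)) \<le> R"
    and "0 < \<epsilon>"
  shows "\<exists>z. abv (z - c) \<le> R \<and> abv (w + (z - c) * (1 + S z)) < \<epsilon>"
proof -
  define \<phi> where "\<phi> z = c - w / (1 + S z)" for z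
  define \<psi> where "\<psi> s = abv w / (1 - \<sigma> / (1 - s / d))" for s
  have \<sigma>0: "0 \<le> \<sigma>"
    unfolding \<sigma>_def by (intro sum_nonneg) (simp add: nonneg)
  have u: "\<sigma> < 1 - s / d" "0 < 1 - s / d" "\<sigma> / (1 - s / d) < 1" if "s \<le> R" for s
  proof -
    have "s / d \<le> R / d"
      using that d by (simp add: divide_right_mono)
    then show "\<sigma> < 1 - s / d" using R by linarith
    then show "0 < 1 - s / d" using \<sigma>0 by linarith
    with \<open>\<sigma> < 1 - s / d\<close> show "\<sigma> / (1 - s / d) < 1" by simp
  qed
  have dist: "abv (c - y j) * (1 - s / d) \<le> abv (z - y j)" "0 < abv (c - y j)"
      "0 < abv (c - y j) * (1 - s / d)" "z - y j \<noteq> 0"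
    if "j \<in> J" "abv (z - c) \<le> s" "s \<le> R" for j z s
  proof -
    show 1: "abv (c - y j) * (1 - s / d) \<le> abv (z - y j)"
      using abv_diff_ge_scaled d that by blast
    show 2: "0 < abv (c - y j)"
      using d(1) d(2)[OF that(1)] by linarith
    then show "0 < abv (c - y j) * (1 - s / d)"
      using u that by simp
    with 1 show "z - y j \<noteq> 0"
      using abv_pos_iff by (metis order.strict_trans2)
  qed
  have S_le: "abv (S z) \<le> \<sigma> / (1 - s / d)" if "abv (z - c) \<le> s" "s \<le> R" for z s
  proof -
    have "abv (S z) \<le> (\<Sum>j\<in>J. abv (v j / (z - y j)))"
      unfolding S_def by (rule abv_sum)
    also have "\<dots> \<le> (\<Sum>j\<in>J. abv (v j) / (abv (c - y j) * (1 - s / d)))"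
    proof (intro sum_mono)
      fix j assume "j \<in> J"
      then show "abv (v j / (z - y j)) \<le> abv (v j) / (abv (c - y j) * (1 - s / d))"
        unfolding abv_divide using dist[of j z s] that by (intro frac_le nonneg) auto
    qed
    also have "\<dots> = \<sigma> / (1 - s / d)"
      unfolding \<sigma>_def sum_divide_distrib by (simp add: divide_divide_eq_left)
    finally show ?thesis .
  qed
  have S_ge: "1 - \<sigma> / (1 - s / d) \<le> abv (1 + S z)" if "abv (z - c) \<le> s" "s \<le> R" for z s
    using S_le[OF that] abv_diff_ge[of 1 "- S z"] by simp
  have S_nz: "1 + S z \<noteq> 0" if "abv (z - c) \<le> R" for z
    using S_ge[OF that order_refl] u(3)[of R] by fastforce
  have \<phi>_le: "abv (\<phi> z - c) \<le> \<psi> s" if "abv (z - c) \<le> s" "s \<le> R" for z s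
  proof -
    have "abv (\<phi> z - c) = abv w / abv (1 + S z)"
      by (simp add: \<phi>_def abv_divide)
    also have "\<dots> \<le> \<psi> s"
      unfolding \<psi>_def using S_ge[OF that] u(3)[OF that(2)]
      by (intro frac_le nonneg) linarith+
    finally show ?thesis .
  qed
  have \<psi>_mono: "\<psi> s \<le> \<psi> r" if "s \<le> r" "r \<le> R" for s r
  proof -
    have "1 - r / d \<le> 1 - s / d"
      using that d by (simp add: divide_right_mono)
    then have "\<sigma> / (1 - s / d) \<le> \<sigma> / (1 - r / d)"
      using u[OF that(2)] \<sigma>0 by (intro divide_left_mono mult_pos_pos) auto
    then show ?thesis
      unfolding \<psi>_def using u(3)[OF that(2)] by (intro frac_le nonneg) auto
  qed
  have \<phi>_diff: "abv (\<phi> z' - \<phi> z) \<le> \<psi> r - \<psi> s"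
    if z: "abv (z - c) \<le> s" "abv (z' - c) \<le> r" "abv (z' - z) \<le> r - s" and r: "s \<le> r" "r \<le> R"
    for z z' s r
  proof -
    have s: "s \<le> R" using r by simp
    let ?A = "1 - s / d" and ?B = "1 - r / d"
    have A: "0 < ?A" "\<sigma> < ?A" and B: "0 < ?B" "\<sigma> < ?B"
      using u s r by auto
    have nz: "1 + S z \<noteq> 0" "1 + S z' \<noteq> 0"
      using S_nz z s r by auto
    have "S z - S z' = (\<Sum>j\<in>J. v j * (z' - z) / ((z - y j) * (z' - y j)))"
      unfolding S_def sum_subtractf[symmetric]
    proof (intro sum.cong refl)
      fix j assume "j \<in> J"
      then have "z - y j \<noteq> 0" "z' - y j \<noteq> 0"
        using dist(4) z s r by blast+
      then show "v j / (z - y j) - v j / (z' - y j) = v j * (z' - z) / ((z - y j) * (z' - y j))"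
        by (simp add: diff_frac_eq algebra_simps)
    qed
    then have "abv (S z - S z') \<le> (\<Sum>j\<in>J. abv (v j * (z' - z) / ((z - y j) * (z' - y j))))"
      by (simp only: abv_sum)
    also have "\<dots> \<le> (\<Sum>j\<in>J. abv (v j) / abv (c - y j) * ((r - s) / (d * ?A * ?B)))"
    proof (intro sum_mono)
      fix j assume j: "j \<in> J"
      let ?D = "abv (c - y j)"
      note a = dist[OF j z(1) s] and b = dist[OF j z(2) r(2)]
      have "?D * d \<le> ?D * ?D"
        using a d j by (intro mult_left_mono) auto
      then have "(?D * d) * (?A * ?B) \<le> (?D * ?D) * (?A * ?B)"
        using A B by (intro mult_right_mono) auto
      also have "\<dots> = (?D * ?A) * (?D * ?B)"
        by simp
      also have "\<dots> \<le> abv (z - y j) * abv (z' - y j)"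
        using a b by (intro mult_mono nonneg) auto
      finally have *: "?D * d * (?A * ?B) \<le> abv (z - y j) * abv (z' - y j)" .
      have **: "0 < ?D * d * (?A * ?B)"
        using a(2) d(1) A(1) B(1) by simp
      have "abv (v j * (z' - z) / ((z - y j) * (z' - y j)))
          = abv (v j) * abv (z' - z) / (abv (z - y j) * abv (z' - y j))"
        by (simp add: abv_divide mult)
      also have "\<dots> \<le> abv (v j) * (r - s) / (?D * d * (?A * ?B))"
        using * ** z r by (intro frac_le mult_nonneg_nonneg mult_left_mono nonneg) auto
      also have "\<dots> = abv (v j) / ?D * ((r - s) / (d * ?A * ?B))"
        by (simp add: mult.assoc)
      finally show "abv (v j * (z' - z) / ((z - y j) * (z' - y j)))
          \<le> abv (v j) / ?D * ((r - s) / (d * ?A * ?B))" .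
    qed
    also have "\<dots> = \<sigma> * ((r - s) / (d * ?A * ?B))"
      by (simp only: \<sigma>_def sum_distrib_right)
    finally have S_diff: "abv (S z - S z') \<le> \<sigma> * ((r - s) / (d * ?A * ?B))" .
    have "\<phi> z' - \<phi> z = w * (S z' - S z) / ((1 + S z') * (1 + S z))"
      using nz by (simp add: \<phi>_def diff_frac_eq algebra_simps)
    then have "abv (\<phi> z' - \<phi> z) = abv w * abv (S z - S z') / (abv (1 + S z') * abv (1 + S z))"
      by (simp add: abv_divide mult abv_commute[of "S z'"])
    also have "\<dots> \<le> abv w * (\<sigma> * ((r - s) / (d * ?A * ?B))) / ((1 - \<sigma> / ?B) * (1 - \<sigma> / ?A))"
      using S_ge[OF z(1) s] S_ge[OF z(2) r(2)] u(3)[OF s] u(3)[OF r(2)] S_diff A B r d \<sigma>0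
      by (intro frac_le mult_mono mult_left_mono mult_nonneg_nonneg mult_pos_pos nonneg) auto
    \<comment> \<open>The estimates above are equalities for the real function \<open>\<psi>\<close>, so nothing is lost here.\<close>
    also have "\<dots> = \<psi> r - \<psi> s"
    proof -
      have e: "?A - ?B = (r - s) / d"
        by (simp add: diff_divide_distrib)
      have cancel: "\<sigma> * (E / d) / ((B - \<sigma>) * (A - \<sigma>))
          = \<sigma> * (E / (d * A * B)) / ((B - \<sigma>) / B * ((A - \<sigma>) / A))"
        if "0 < A" "0 < B" for A B E
        using that by simp
      have "1 - \<sigma> / u = (u - \<sigma>) / u" if "0 < u" for u
        using that by (simp add: diff_divide_distrib)
      note g = this[OF A(1)] this[OF B(1)]
      have "\<psi> r - \<psi> s = abv w * (?B / (?B - \<sigma>) - ?A / (?A - \<sigma>))"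
        unfolding \<psi>_def g by (simp add: right_diff_distrib)
      also have "?B / (?B - \<sigma>) - ?A / (?A - \<sigma>) = \<sigma> * (?A - ?B) / ((?B - \<sigma>) * (?A - \<sigma>))"
        using A B by (subst diff_frac_eq) (auto simp: algebra_simps)
      also have "\<dots> = \<sigma> * ((r - s) / (d * ?A * ?B)) / ((1 - \<sigma> / ?B) * (1 - \<sigma> / ?A))"
        unfolding e g using A(1) B(1) by (rule cancel)
      finally show ?thesis
        by simp
    qed
    finally show ?thesis .
  qed
  define z where "z k = (\<phi> ^^ k) c" for k
  define s where "s k = (\<psi> ^^ k) 0" for k
  have z_Suc: "z (Suc k) = \<phi> (z k)" and s_Suc: "s (Suc k) = \<psi> (s k)" for k
    by (simp_all add: z_def s_def)
  have step: "0 \<le> s k \<and> s k \<le> s (Suc k) \<and> s (Suc k) \<le> R \<and> abv (z k - c) \<le> s k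
      \<and> abv (z (Suc k) - z k) \<le> s (Suc k) - s k" for k
  proof (induction k)
    case 0
    have "\<psi> 0 \<le> R"
      using \<psi>_mono[of 0 R] R by (simp add: \<psi>_def)
    moreover have "0 \<le> \<psi> 0"
      using u(3)[of 0] R by (simp add: \<psi>_def nonneg)
    moreover have "abv (\<phi> c - c) \<le> \<psi> 0"
      using \<phi>_le[of c 0] R by simp
    ultimately show ?case
      by (simp add: z_def s_def)
  next
    case (Suc k)
    moreover have "abv (z (Suc k) - c) \<le> s (Suc k)"
      using \<phi>_le[of "z k" "s k"] Suc by (simp add: z_Suc s_Suc)
    moreover have "s (Suc k) \<le> s (Suc (Suc k))"
      using \<psi>_mono[of "s k" "s (Suc k)"] Suc by (simp add: s_Suc)
    moreover have "s (Suc (Suc k)) \<le> R"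
      using \<psi>_mono[of "s (Suc k)" R] Suc R by (simp add: s_Suc \<psi>_def)
    moreover have "abv (z (Suc (Suc k)) - z (Suc k)) \<le> s (Suc (Suc k)) - s (Suc k)"
      using \<phi>_diff[of "z k" "s k" "z (Suc k)" "s (Suc k)"] Suc calculation
      by (simp add: z_Suc s_Suc)
    ultimately show ?case
      by simp
  qed
  have "incseq s"
    using step by (intro incseq_SucI) blast
  moreover have "s k \<le> R" for k
    using step[of k] by linarith
  ultimately obtain L where "s \<longlonglongrightarrow> L"
    using incseq_convergent by blast
  then have "(\<lambda>k. s (Suc k) - s k) \<longlonglongrightarrow> L - L"
    by (intro tendsto_diff) (simp_all add: filterlim_sequentially_Suc)
  then have "\<forall>\<^sub>F k in sequentially. s (Suc k) - s k < \<epsilon> / 2"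
    using \<open>0 < \<epsilon>\<close> by (intro order_tendstoD(2)) auto
  then obtain k where k: "s (Suc k) - s k < \<epsilon> / 2"
    by (auto simp: eventually_sequentially)
  have zR: "abv (z k - c) \<le> R"
    using step[of k] by linarith
  have residual: "z k - \<phi> (z k) = (z k - c) + w / (1 + S (z k))"
    by (simp add: \<phi>_def)
  have "w + (z k - c) * (1 + S (z k)) = (1 + S (z k)) * (z k - \<phi> (z k))"
    unfolding residual distrib_left[of "1 + S (z k)"]
    using S_nz[OF zR] by (simp add: mult.commute)
  then have "abv (w + (z k - c) * (1 + S (z k))) = abv (1 + S (z k)) * abv (z (Suc k) - z k)"
    by (simp add: mult z_Suc abv_commute)
  also have "\<dots> \<le> 2 * (s (Suc k) - s k)"
  proof (intro mult_mono)
    \<comment> \<open>\<open>|S| \<le> \<sigma> / (1 - R / d) < 1\<close> on the disk.\<close>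
    show "abv (1 + S (z k)) \<le> 2"
      using triangle[of 1 "S (z k)"] S_le[OF zR order_refl] u(3)[of R] by simp
  qed (use step[of k] nonneg in auto)
  also have "\<dots> < \<epsilon>"
    using k by simp
  finally show ?thesis
    using zR by blast
qed

text \<open>
  This replaces completeness. If all roots \<open>r\<close> lie outside the disk, each factor satisfies
  \<open>|z - r| \<ge> |r - c| - R > 0\<close> there, so \<open>|f|\<close> has a positive lower bound.
\<close>

lemma root_in_cball:
  fixes f :: "'a poly"
  assumes factored: "f = smult l (\<Prod>r\<in>#A. [:- r, 1:])" and "l \<noteq> 0"
    and approx: "\<And>\<epsilon>. 0 < \<epsilon> \<Longrightarrow> \<exists>z. abv (z - c) \<le> R \<and> abv (poly f z) < \<epsilon>"
  shows "\<exists>z\<in>abv_cball abv c R. poly f z = 0"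
proof (rule ccontr)
  assume no_root: "\<not> ?thesis"
  have "\<exists>\<delta>>0. \<forall>z. abv (z - c) \<le> R \<longrightarrow> \<delta> \<le> abv (poly (\<Prod>r\<in>#B. [:- r, 1:]) z)"
    if "\<forall>r\<in>#B. R < abv (r - c)" for B
    using that
  proof (induction B)
    case empty
    show ?case
      by (intro exI[of _ 1]) simp
  next
    case (add r B)
    then obtain \<delta> where \<delta>: "0 < \<delta>"
        "\<And>z. abv (z - c) \<le> R \<Longrightarrow> \<delta> \<le> abv (poly (\<Prod>r\<in>#B. [:- r, 1:]) z)"
      by auto
    show ?case
    proof (intro exI[of _ "(abv (r - c) - R) * \<delta>"] conjI allI impI)
      show "0 < (abv (r - c) - R) * \<delta>"
        using \<delta> add.prems by simp
    next
      fix z assume z: "abv (z - c) \<le> R"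
      have "abv (r - c) - R \<le> abv (z - r)"
        using abv_diff_triangle[of r c z] z by (simp add: abv_commute)
      then have "(abv (r - c) - R) * \<delta> \<le> abv (z - r) * abv (poly (\<Prod>r\<in>#B. [:- r, 1:]) z)"
        using \<delta> z by (intro mult_mono nonneg) auto
      also have "\<dots> = abv (poly (\<Prod>r\<in>#add_mset r B. [:- r, 1:]) z)"
        by (simp add: algebra_simps flip: mult)
      finally show "(abv (r - c) - R) * \<delta> \<le> abv (poly (\<Prod>r\<in>#add_mset r B. [:- r, 1:]) z)" .
    qed
  qed
  moreover have "R < abv (r - c)" if "r \<in># A" for r
  proof -
    have "poly (\<Prod>r\<in>#A. [:- r, 1:]) r = 0"
      using that by (subst poly_prod_mset) (auto intro!: bexI[of _ r] simp: prod_mset_zero_iff image_iff)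
    then show ?thesis
      using no_root factored by (auto simp: abv_cball_def not_le)
  qed
  ultimately obtain \<delta> where \<delta>: "0 < \<delta>"
      "\<And>z. abv (z - c) \<le> R \<Longrightarrow> \<delta> \<le> abv (poly (\<Prod>r\<in>#A. [:- r, 1:]) z)"
    by blast
  obtain z where z: "abv (z - c) \<le> R" "abv (poly f z) < abv l * \<delta>"
    using approx[of "abv l * \<delta>"] \<delta> \<open>l \<noteq> 0\<close> by (auto simp: abv_pos_iff)
  then show False
    using \<delta>(2)[OF z(1)] \<open>l \<noteq> 0\<close> by (simp add: factored mult abv_pos_iff)
qed

end

section \<open>Disjoint disks that contain a zero\<close>

lemma min_dist_le:
  fixes x :: "'a::field ^ 'n"
  assumes "j \<noteq> i"
  shows "min_dist abv x $ i \<le> abv (x $ i - x $ j)"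
  using assms by (auto simp: min_dist_def intro!: Min_le)

context absolute_value
begin

lemma min_dist_pos:
  fixes x :: "'a ^ 'n"
  assumes "inj (\<lambda>i. x $ i)" "CARD('n) \<ge> 2"
  shows "0 < min_dist abv x $ i"
proof -
  have "UNIV - {i} \<noteq> {}"
  proof
    assume "UNIV - {i} = {}"
    then have "card (UNIV - {i}) = 0"
      by (simp only: card.empty)
    with assms show False
      by (simp add: card_Diff_singleton)
  qed
  with assms show ?thesis
    by (auto simp: min_dist_def abv_pos_iff inj_eq)
qed

text \<open>
  The hypotheses \<open>v\<close> are \<open>sum_abs_le_p_norm\<close> for \<open>{i}\<close> and \<open>UNIV - {i}\<close>. They make \<open>R = \<alpha>(t) |W\<^sub>i|\<close>
  satisfy \<open>\<psi>(R) \<le> R\<close> for the majorant \<open>\<psi>\<close>, since \<open>R / d\<^sub>i \<le> \<alpha>(t) t\<close>, \<open>\<sigma> \<le> a t\<close> and \<open>\<alpha>(t)\<close> is the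
  fixed point.
\<close>

lemma weierstrass_disk_contains_root:
  fixes f :: "'a poly" and x :: "'a ^ 'n"
  defines "W \<equiv> weierstrass_corr f x" and "d \<equiv> min_dist abv x"
  assumes factored: "f = smult (lead_coeff f) (\<Prod>r\<in>#A. [:- r, 1:])"
    and n: "degree f = CARD('n)" "CARD('n) \<ge> 2" and inj: "inj (\<lambda>i. x $ i)"
    and a: "1 \<le> a" and t: "0 \<le> t" "t \<le> 1 / (1 + sqrt a)\<^sup>2"
    and v: "abv (W $ i) / d $ i \<le> t" "(\<Sum>j\<in>UNIV - {i}. abv (W $ j) / d $ j) \<le> a * t"
  shows "\<exists>z\<in>abv_cball abv (x $ i) (alpha_fun a t * abv (W $ i)). poly f z = 0"
proof -
  let ?\<alpha> = "alpha_fun a t"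
  let ?R = "?\<alpha> * abv (W $ i)"
  let ?S = "\<lambda>z. \<Sum>j\<in>UNIV - {i}. W $ j / (z - x $ j)"
  let ?\<sigma> = "\<Sum>j\<in>UNIV - {i}. abv (W $ j) / abv (x $ i - x $ j)"
  have d_pos: "0 < d $ j" for j
    unfolding d_def using inj n by (intro min_dist_pos)
  have R: "0 \<le> ?R"
    using alpha_pos[OF a t] nonneg by (simp add: less_imp_le)
  have Rd: "?R / d $ i \<le> ?\<alpha> * t"
    using mult_left_mono[OF v(1), of ?\<alpha>] alpha_pos[OF a t] by simp
  have "?\<sigma> \<le> (\<Sum>j\<in>UNIV - {i}. abv (W $ j) / d $ j)"
  proof (intro sum_mono frac_le nonneg d_pos)
    fix j assume "j \<in> UNIV - {i}"
    then show "d $ j \<le> abv (x $ i - x $ j)"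
      unfolding d_def using min_dist_le[of i j abv x] by (simp add: abv_commute)
  qed auto
  then have \<sigma>: "?\<sigma> \<le> a * t"
    using v by linarith
  have contr: "a * t < 1 - ?\<alpha> * t" "0 \<le> a * t"
    using alpha_margin[OF a t] a t by auto
  have bound: "abv (W $ i) / (1 - ?\<sigma> / (1 - ?R / d $ i)) \<le> ?R"
  proof -
    have "?\<sigma> / (1 - ?R / d $ i) \<le> a * t / (1 - ?\<alpha> * t)"
      using \<sigma> Rd contr by (intro frac_le) linarith+
    moreover have "a * t / (1 - ?\<alpha> * t) < 1"
      using contr by simp
    ultimately have "abv (W $ i) / (1 - ?\<sigma> / (1 - ?R / d $ i))
        \<le> abv (W $ i) / (1 - a * t / (1 - ?\<alpha> * t))"
      by (intro frac_le nonneg) linarith+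
    also have "\<dots> = abv (W $ i) * (1 / (1 - a * t / (1 - ?\<alpha> * t)))"
      by simp
    also have "\<dots> = ?R"
      unfolding alpha_fixed_point[OF a t] by simp
    finally show ?thesis .
  qed
  \<comment> \<open>An upper bound on the disk for the factor \<open>a\<^sub>0 (\<Prod>j\<noteq>i. z - x\<^sub>j)\<close> by which \<open>f\<close> differs from the residual.\<close>
  define M where "M = abv (lead_coeff f) * (\<Prod>j\<in>UNIV - {i}. ?R + abv (x $ i - x $ j))"
  have "0 \<le> ?R + abv (x $ i - x $ j)" for j
    using R nonneg[of "x $ i - x $ j"] by linarith
  then have M: "0 \<le> M"
    unfolding M_def by (intro mult_nonneg_nonneg nonneg prod_nonneg) blast
  show ?thesis
  proof (rule root_in_cball[OF factored])
    have "f \<noteq> 0"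
      using n by auto
    then show "lead_coeff f \<noteq> 0"
      by (rule leading_coeff_neq_0)
  next
    fix \<epsilon> :: real assume "0 < \<epsilon>"
    then have \<epsilon>: "0 < \<epsilon> / (M + 1)"
      using M by simp
    have sep: "d $ i \<le> abv (x $ i - x $ j)" if "j \<in> UNIV - {i}" for j
      using that by (simp add: d_def min_dist_le)
    have "?\<sigma> < 1 - ?R / d $ i"
      using \<sigma> contr Rd by linarith
    from approximate_fixed_point[OF d_pos sep R this bound \<epsilon>]
    obtain z where z: "abv (z - x $ i) \<le> ?R"
        "abv (W $ i + (z - x $ i) * (1 + ?S z)) < \<epsilon> / (M + 1)"
      by blast
    have "z \<noteq> x $ j" if "j \<noteq> i" for j
    proof
      assume "z = x $ j"
      with z sep[of j] that have "d $ i \<le> ?R"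
        by (simp add: abv_commute)
      then have "1 \<le> ?R / d $ i"
        using d_pos by simp
      with Rd contr show False
        by linarith
    qed
    then have "poly f z = lead_coeff f * (\<Prod>j\<in>UNIV - {i}. z - x $ j)
        * (W $ i + (z - x $ i) * (1 + ?S z))"
      unfolding W_def using n inj by (intro weierstrass_representation_at)
    then have "abv (poly f z) = abv (lead_coeff f) * (\<Prod>j\<in>UNIV - {i}. abv (z - x $ j))
        * abv (W $ i + (z - x $ i) * (1 + ?S z))"
      by (simp only: mult abv_prod)
    also have "\<dots> \<le> M * abv (W $ i + (z - x $ i) * (1 + ?S z))"
      unfolding M_def
    proof (intro mult_right_mono mult_left_mono prod_mono conjI nonneg)
      fix j
      show "abv (z - x $ j) \<le> ?R + abv (x $ i - x $ j)"
        using abv_diff_triangle[of z "x $ j" "x $ i"] z(1) by linarith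
    qed
    also have "\<dots> \<le> M * (\<epsilon> / (M + 1))"
      using z M by (intro mult_left_mono) auto
    also have "\<dots> < \<epsilon>"
      using M \<open>0 < \<epsilon>\<close> by (simp add: field_simps)
    finally show "\<exists>z. abv (z - x $ i) \<le> ?R \<and> abv (poly f z) < \<epsilon>"
      using z(1) by blast
  qed
qed

text \<open>
  At a common point, \<open>|x\<^sub>i - x\<^sub>j| \<le> c (|w\<^sub>i| + |w\<^sub>j|)\<close>, and both \<open>d\<^sub>i\<close> and \<open>d\<^sub>j\<close> are at most \<open>|x\<^sub>i - x\<^sub>j|\<close>.
\<close>

lemma weierstrass_disks_disjoint:
  fixes w x :: "'a ^ 'n"
  defines "d \<equiv> min_dist abv x"
  assumes inj: "inj (\<lambda>i. x $ i)" "CARD('n) \<ge> 2" and "0 \<le> c" "i \<noteq> j"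
    and less: "c * (abv (w $ i) / d $ i + abv (w $ j) / d $ j) < 1"
  shows "abv_cball abv (x $ i) (c * abv (w $ i)) \<inter> abv_cball abv (x $ j) (c * abv (w $ j)) = {}"
proof (rule ccontr)
  let ?D = "abv (x $ i - x $ j)"
  have d: "0 < d $ k" for k
    unfolding d_def using inj by (rule min_dist_pos)
  have D: "d $ i \<le> ?D" "d $ j \<le> ?D"
    using min_dist_le[of j i abv x] min_dist_le[of i j abv x] \<open>i \<noteq> j\<close>
    by (simp_all add: d_def abv_commute)
  have W: "abv (w $ k) \<le> abv (w $ k) / d $ k * ?D" if "d $ k \<le> ?D" for k
    using mult_left_mono[OF that, of "abv (w $ k) / d $ k"] d[of k] nonneg by simp
  assume "\<not> ?thesis"
  then obtain z where "abv (z - x $ i) \<le> c * abv (w $ i)" "abv (z - x $ j) \<le> c * abv (w $ j)"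
    by (auto simp: abv_cball_def)
  then have "?D \<le> c * (abv (w $ i) + abv (w $ j))"
    using abv_diff_triangle[of "x $ i" "x $ j" z]
    by (simp add: abv_commute[of "x $ i" z] distrib_left)
  also have "\<dots> \<le> c * (abv (w $ i) / d $ i * ?D + abv (w $ j) / d $ j * ?D)"
    using \<open>0 \<le> c\<close> W D by (intro mult_left_mono add_mono) auto
  also have "\<dots> = c * (abv (w $ i) / d $ i + abv (w $ j) / d $ j) * ?D"
    by (simp only: distrib_right mult.assoc)
  also have "\<dots> < 1 * ?D"
    using less D(1) d[of i] by (intro mult_strict_right_mono) auto
  finally show False
    by simp
qed

end

text \<open>
  Pigeonhole: choosing a root in each set gives \<open>CARD('n)\<close> distinct roots, which is the degree, so there
  are no others; and the orders, each at least \<open>1\<close>, sum to at most the number of roots.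
\<close>

lemma roots_in_disjoint_sets:
  fixes f :: "'a::idom poly" and D :: "'n::finite \<Rightarrow> 'a set"
  assumes deg: "degree f = CARD('n)" and disj: "disjoint_family D"
    and root: "\<And>i. \<exists>z\<in>D i. poly f z = 0"
  shows "\<exists>!z. z \<in> D i \<and> poly f z = 0" "poly f z = 0 \<Longrightarrow> order z f = 1"
proof -
  let ?Z = "{z. poly f z = 0}"
  have "f \<noteq> 0"
    using deg by auto
  then have fin: "finite ?Z"
    by (rule poly_roots_finite)
  obtain \<xi> where \<xi>: "\<xi> i \<in> D i" "poly f (\<xi> i) = 0" for i
    using root by metis
  have D: "i = j" if "z \<in> D i" "z \<in> D j" for i j z
    using disj that by (auto simp: disjoint_family_on_def)
  then have "inj \<xi>"
    using \<xi>(1) by (metis injI)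
  then have "card (range \<xi>) = CARD('n)"
    by (simp add: card_image)
  moreover have "range \<xi> \<subseteq> ?Z"
    using \<xi> by auto
  moreover have "card ?Z \<le> CARD('n)"
    using card_poly_roots_bound[OF \<open>f \<noteq> 0\<close>] deg by simp
  ultimately have "card ?Z = CARD('n)"
    using card_mono[OF fin \<open>range \<xi> \<subseteq> ?Z\<close>] by simp
  then have Z: "range \<xi> = ?Z" "card ?Z = CARD('n)"
    using card_subset_eq[OF fin \<open>range \<xi> \<subseteq> ?Z\<close>] \<open>card (range \<xi>) = CARD('n)\<close> by simp_all
  show "\<exists>!z. z \<in> D i \<and> poly f z = 0"
  proof (rule ex1I)
    show "\<xi> i \<in> D i \<and> poly f (\<xi> i) = 0"
      using \<xi> by simp
  next
    fix z assume z: "z \<in> D i \<and> poly f z = 0"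
    then obtain j where "z = \<xi> j"
      using Z(1) by auto
    then show "z = \<xi> i"
      using D[of z i j] z \<xi>(1) by auto
  qed
  show "order z f = 1" if "poly f z = 0"
  proof (rule ccontr)
    have ge: "1 \<le> order y f" if "y \<in> ?Z" for y
      using that order_root[of f y] \<open>f \<noteq> 0\<close> by simp
    assume "order z f \<noteq> 1"
    then have "1 < order z f"
      using ge[of z] that by simp
    then have "(\<Sum>y\<in>?Z. 1) < (\<Sum>y\<in>?Z. order y f)"
      using fin ge that by (intro sum_strict_mono_ex1) auto
    also have "\<dots> \<le> CARD('n)"
      using sum_order_le_degree[OF \<open>f \<noteq> 0\<close>] deg by simp
    finally show False
      using Z(2) by simp
  qed
qed

text \<open>
  Put \<open>m = 2\<^bsup>1/q\<^esup> \<in> [1, 2]\<close>. Since \<open>\<beta>(t) t \<le> 1 / (1 + \<surd>a)\<close>, it suffices that \<open>m < 1 + \<surd>a\<close>. For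
  \<open>n \<ge> 3\<close> one has \<open>m \<le> a\<close>, and \<open>m < 1 + \<surd>m\<close> holds on \<open>[1, 2]\<close>. For \<open>n = 2\<close> one has \<open>a = 1\<close>, and
  \<open>m < 2\<close> holds unless \<open>q = 1\<close>, that is \<open>p = \<infinity>\<close>; then strictness comes from \<open>t < 1 / 4\<close>.
\<close>

lemma beta_two_disks_lt_1:
  fixes n :: nat and p q :: ereal
  defines "e \<equiv> real_of_ereal (1 / q)"
  assumes n: "2 \<le> n" and pq: "conjugate_exponents p q" and a: "a = (real n - 1) powr e"
    and t: "0 \<le> t" "t \<le> 1 / (1 + sqrt a)\<^sup>2"
    and strict: "n = 2 \<and> p = \<infinity> \<longrightarrow> t < 1 / (1 + sqrt a)\<^sup>2"
  shows "beta_fun a t * (2 powr e * t) < 1"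
proof -
  define m where "m = 2 powr e"
  have e: "0 \<le> e" "e \<le> 1" "p \<noteq> \<infinity> \<Longrightarrow> e < 1"
    using pq by (cases rule: conjugate_exponents_cases; force simp: e_def)+
  have m: "1 \<le> m" "m \<le> 2" "p \<noteq> \<infinity> \<Longrightarrow> m < 2"
    using e powr_mono[of 0 e "2::real"] powr_mono[of e 1 "2::real"] powr_less_mono[of e 1 "2::real"]
    by (auto simp: m_def)
  have a1: "1 \<le> a"
    unfolding a using n e by (intro ge_one_powr_ge_zero) auto
  have \<beta>: "beta_fun a t * t \<le> 1 / (1 + sqrt a)"
    using a1 t by (rule beta_times_le)
  have "m * (beta_fun a t * t) < 1"
  proof (cases "n = 2")
    case False
    then have "m \<le> a"
      unfolding m_def a using n e by (intro powr_mono2) auto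
    define w where "w = sqrt m"
    have w: "1 \<le> w" "w\<^sup>2 = m" "w \<le> sqrt a"
      using m \<open>m \<le> a\<close> by (auto simp: w_def)
    have "w\<^sup>2 < 1 + w"
    proof (cases "w = 1")
      case False
      then show ?thesis
        using w m by linarith
    qed simp
    then have "m < 1 + sqrt a"
      using w by linarith
    have "m * (beta_fun a t * t) \<le> m * (1 / (1 + sqrt a))"
      using \<beta> m by (intro mult_left_mono) auto
    also have "\<dots> < 1"
      using \<open>m < 1 + sqrt a\<close> m by (simp add: divide_simps)
    finally show ?thesis .
  next
    case True
    then have "a = 1"
      by (simp add: a)
    then have \<beta>t: "beta_fun a t * t = 2 * t" "t \<le> 1 / 4" "n = 2 \<and> p = \<infinity> \<longrightarrow> t < 1 / 4"
      using t strict by (simp_all add: beta_fun_def power2_eq_square)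
    show ?thesis
    proof (cases "p = \<infinity>")
      case p: True
      have "m * (2 * t) \<le> 2 * (2 * t)"
        using m t by (intro mult_right_mono) auto
      moreover have "t < 1 / 4"
        using \<beta>t(3) p True by blast
      ultimately show ?thesis
        unfolding \<beta>t(1) by linarith
    next
      case False
      have "m * (2 * t) \<le> m * (2 * (1 / 4))"
        using m \<beta>t by (intro mult_left_mono) auto
      then show ?thesis
        unfolding \<beta>t(1) using m(3)[OF False] by linarith
    qed
  qed
  then show ?thesis
    by (simp add: m_def mult_ac)
qed

theorem theorem3p4:
  fixes abv :: "'a::alg_closed_field \<Rightarrow> real"
    and f :: "'a poly"
    and x :: "'a ^ 'n"
    and p q :: ereal
    and a :: real
  assumes "absolute_value abv"
    and "degree f = CARD('n)" and "CARD('n) \<ge> 2"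
    and "conjugate_exponents p q"
    and "a = (real CARD('n) - 1) powr real_of_ereal (1 / q)"
    and "inj (\<lambda>i. x $ i)"
    and "init_fun abv p f x \<le> 1 / (1 + sqrt a)\<^sup>2"
    and "CARD('n) = 2 \<and> p = \<infinity> \<longrightarrow> init_fun abv p f x < 1 / (1 + sqrt a)\<^sup>2"
  shows "(\<forall>z. poly f z = 0 \<longrightarrow> order z f = 1) \<and>
    (\<forall>c\<in>{alpha_fun a (init_fun abv p f x)..beta_fun a (init_fun abv p f x)}.
       let D = (\<lambda>i. abv_cball abv (x $ i) (c * abv (weierstrass_corr f x $ i)))
       in disjoint_family D \<and> (\<forall>i. \<exists>!z. z \<in> D i \<and> poly f z = 0))"
proof -
  interpret absolute_value abv
    by fact
  define W d t where "W = weierstrass_corr f x" and "d = min_dist abv x"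
    and "t = init_fun abv p f x"
  define v where "v = abv_quot abv W d"
  define e where "e = real_of_ereal (1 / q)"
  define D where "D c i = abv_cball abv (x $ i) (c * abv (W $ i))" for c i
  have d: "0 < d $ i" for i
    unfolding d_def using assms by (intro min_dist_pos)
  have v_abs: "\<bar>v $ i\<bar> = abv (W $ i) / d $ i" for i
    using d[of i] nonneg by (simp add: v_def abv_quot_def)
  have hoelder: "(\<Sum>i\<in>S. abv (W $ i) / d $ i) \<le> real (card S) powr e * t" for S
    using sum_abs_le_p_norm[OF assms(4), of v S]
    by (simp only: v_abs) (simp add: e_def t_def init_fun_def v_def W_def d_def)
  have t: "0 \<le> t" "t \<le> 1 / (1 + sqrt a)\<^sup>2"
    using assms by (auto simp: t_def init_fun_def p_norm_nonneg)
  have "0 \<le> e"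
    using assms(4) by (cases rule: conjugate_exponents_cases) (auto simp: e_def)
  then have a: "1 \<le> a"
    using assms by (auto simp: e_def intro!: ge_one_powr_ge_zero)
  have \<beta>: "beta_fun a t * (2 powr e * t) < 1"
    unfolding e_def using assms t by (intro beta_two_disks_lt_1) (auto simp: t_def)
  have "f \<noteq> 0"
    using assms by auto
  then obtain A where A: "f = smult (lead_coeff f) (\<Prod>r\<in>#A. [:- r, 1:])"
    using alg_closed_imp_factorization by blast
  have root: "\<exists>z\<in>D (alpha_fun a t) i. poly f z = 0" for i
    unfolding D_def W_def
  proof (rule weierstrass_disk_contains_root[OF A])
    show "abv (weierstrass_corr f x $ i) / min_dist abv x $ i \<le> t"
      using hoelder[of "{i}"] by (simp add: W_def d_def)
    show "(\<Sum>j\<in>UNIV - {i}. abv (weierstrass_corr f x $ j) / min_dist abv x $ j) \<le> a * t"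
      using hoelder[of "UNIV - {i}"] assms
      by (simp add: W_def d_def e_def card_Diff_singleton of_nat_diff)
  qed (use assms a t in auto)
  have disks: "disjoint_family (D c)" "\<exists>z\<in>D c i. poly f z = 0"
    if c: "alpha_fun a t \<le> c" "c \<le> beta_fun a t" for c i
  proof -
    have c0: "0 \<le> c"
      using alpha_pos[OF a t] c by linarith
    show "disjoint_family (D c)"
    proof (unfold disjoint_family_on_def, intro ballI impI)
      fix i j :: 'n assume ij: "i \<noteq> j"
      have "c * (abv (W $ i) / d $ i + abv (W $ j) / d $ j) \<le> beta_fun a t * (2 powr e * t)"
        using hoelder[of "{i, j}"] ij c c0 d nonneg by (intro mult_mono add_nonneg_nonneg) (auto simp: less_imp_le)
      then show "D c i \<inter> D c j = {}"
        unfolding D_def using assms c0 ij \<beta> by (intro weierstrass_disks_disjoint) (auto simp: d_def)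
    qed
    have "D (alpha_fun a t) i \<subseteq> D c i"
      unfolding D_def abv_cball_def using c mult_right_mono[OF c(1) nonneg]
      by (auto intro: order_trans)
    then show "\<exists>z\<in>D c i. poly f z = 0"
      using root[of i] by blast
  qed
  have "order z f = 1" if "poly f z = 0" for z
    using roots_in_disjoint_sets(2)[OF assms(2) disks] alpha_le_beta[OF a t] that by blast
  moreover have "disjoint_family (D c) \<and> (\<forall>i. \<exists>!z. z \<in> D c i \<and> poly f z = 0)"
    if c: "c \<in> {alpha_fun a t..beta_fun a t}" for c
  proof -
    have "alpha_fun a t \<le> c" "c \<le> beta_fun a t"
      using c by auto
    note D = disks[OF this]
    show ?thesis
      using roots_in_disjoint_sets(1)[OF assms(2) D] D(1) by blast
  qed
  ultimately show ?thesis
    unfolding Let_def t_def W_def D_def by blast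
qed

end
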